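(* Let $G$ be a group generated by an abelian normal subgroup $A$ of $G$ and an element $t\in G$ such that $t^2\in A$ and $t^{-1}at=a^{-1}$ for all $a\in A$. Then $G$ is a $p$-UT group.
   Context: For a group $G$, $\mathcal{U}_1(\mathbb{Z}G)$ denotes the group of units of augmentation one of the integral group ring $\mathbb{Z}G$. For $\alpha=\sum_{h\in G}\alpha(h)h\in\mathbb{Z}G$ and $g\in G$, let $C_g$ be the conjugacy class of $g$ in $G$ and set $\tilde{\alpha}(g)=\sum_{h\in C_g}\alpha(h)$. A unit $\alpha\in\mathcal{U}_1(\mathbb{Z}G)$ has the unique trace property if there exists an element $g\in G$, unique up to conjugacy in $G$, such that $\tilde{\alpha}(g)\neq 0$. A group $G$ is a $p$-UT group if every torsion unit in $\mathcal{U}_1(\mathbb{Z}G)$ of prime power order (i.e. whose order is a power of some prime) has the unique trace property. *)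

theory Defs
  imports "HOL-Algebra.Algebra" "HOL-Library.Poly_Mapping"
begin

text \<open>
  The integral group ring of a group given by a carrier: its elements are the finitely
  supported integer functions with support in the carrier, as in
  \<^const>\<open>free_Abelian_group\<close>, and its product is the bilinear extension of the product of \<open>G\<close>.
\<close>

definition group_ring_mult ::
    "('a, 'b) monoid_scheme \<Rightarrow> ('a \<Rightarrow>\<^sub>0 int) \<Rightarrow> ('a \<Rightarrow>\<^sub>0 int) \<Rightarrow> ('a \<Rightarrow>\<^sub>0 int)" where
  "group_ring_mult G x y =
     frag_extend (\<lambda>g. frag_extend (\<lambda>h. frag_of (g \<otimes>\<^bsub>G\<^esub> h)) y) x"

definition integral_group_ring :: "('a, 'b) monoid_scheme \<Rightarrow> ('a \<Rightarrow>\<^sub>0 int) ring" where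
  "integral_group_ring G =
     \<lparr>carrier = {x. Poly_Mapping.keys x \<subseteq> carrier G},
      monoid.mult = group_ring_mult G, one = frag_of \<one>\<^bsub>G\<^esub>, ring.zero = 0, ring.add = (+)\<rparr>"

definition augmentation :: "('a \<Rightarrow>\<^sub>0 int) \<Rightarrow> int" where
  "augmentation x = (\<Sum>g\<in>Poly_Mapping.keys x. Poly_Mapping.lookup x g)"

definition normalized_units :: "('a, 'b) monoid_scheme \<Rightarrow> ('a \<Rightarrow>\<^sub>0 int) monoid" where
  "normalized_units G =
     (units_of (integral_group_ring G))
       \<lparr>carrier := {u \<in> Units (integral_group_ring G). augmentation u = 1}\<rparr>"

definition conjugacy_class :: "('a, 'b) monoid_scheme \<Rightarrow> 'a \<Rightarrow> 'a set" where
  "conjugacy_class G g = {inv\<^bsub>G\<^esub> x \<otimes>\<^bsub>G\<^esub> g \<otimes>\<^bsub>G\<^esub> x | x. x \<in> carrier G}"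

text \<open>
  A conjugacy class may be infinite, so the sum is restricted to the (finite) support.
\<close>

definition partial_augmentation :: "('a, 'b) monoid_scheme \<Rightarrow> ('a \<Rightarrow>\<^sub>0 int) \<Rightarrow> 'a \<Rightarrow> int" where
  "partial_augmentation G x g =
     (\<Sum>h\<in>conjugacy_class G g \<inter> Poly_Mapping.keys x. Poly_Mapping.lookup x h)"

definition unique_trace_property :: "('a, 'b) monoid_scheme \<Rightarrow> ('a \<Rightarrow>\<^sub>0 int) \<Rightarrow> bool" where
  "unique_trace_property G x \<longleftrightarrow>
     (\<exists>g\<in>carrier G. partial_augmentation G x g \<noteq> 0 \<and>
        (\<forall>h\<in>carrier G. partial_augmentation G x h \<noteq> 0 \<longrightarrow> h \<in> conjugacy_class G g))"

text \<open>
  The order is \<open>0\<close> for elements of infinite order, so requiring it to be a prime power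
  already makes the unit a torsion unit. The exponent \<open>0\<close> (the trivial unit) is allowed.
\<close>

definition p_UT_group :: "('a, 'b) monoid_scheme \<Rightarrow> bool" where
  "p_UT_group G \<longleftrightarrow> group G \<and>
     (\<forall>u\<in>carrier (normalized_units G).
        (\<exists>p k::nat. Factorial_Ring.prime p \<and> group.ord (normalized_units G) u = p ^ k) \<longrightarrow>
        unique_trace_property G u)"

text \<open>
  The constructions are well defined. In particular, \<^const>\<open>group.ord\<close> is applied above
  to an actual group.
\<close>

lemma frag_extend_add_fun:
  "frag_extend (\<lambda>i. f i + g i) x = frag_extend f x + frag_extend g x"
  by (simp add: frag_extend_def frag_cmul_distrib2 sum.distrib)

lemma frag_extend_frag_extend:
  "frag_extend f (frag_extend g x) = frag_extend (\<lambda>i. frag_extend f (g i)) x"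
  by (simp add: frag_extend_def[of g] frag_extend_def[of "\<lambda>i. frag_extend f (g i)"]
      frag_extend_sum frag_extend_cmul o_def)

lemma group_ring_mult_closed:
  assumes "group G" "Poly_Mapping.keys x \<subseteq> carrier G" "Poly_Mapping.keys y \<subseteq> carrier G"
  shows "Poly_Mapping.keys (group_ring_mult G x y) \<subseteq> carrier G"
proof -
  interpret group G by fact
  have "Poly_Mapping.keys (frag_extend (\<lambda>h. frag_of (g \<otimes>\<^bsub>G\<^esub> h)) y) \<subseteq> carrier G"
    if "g \<in> carrier G" for g
    using keys_frag_extend[of "\<lambda>h. frag_of (g \<otimes>\<^bsub>G\<^esub> h)" y] assms(3) that by fastforce
  then show ?thesis
    unfolding group_ring_mult_def
    using keys_frag_extend[of "\<lambda>g. frag_extend (\<lambda>h. frag_of (g \<otimes>\<^bsub>G\<^esub> h)) y" x] assms(2)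
    by blast
qed

lemma group_ring_mult_assoc:
  assumes "group G" "Poly_Mapping.keys x \<subseteq> carrier G" "Poly_Mapping.keys y \<subseteq> carrier G"
    "Poly_Mapping.keys z \<subseteq> carrier G"
  shows "group_ring_mult G (group_ring_mult G x y) z = group_ring_mult G x (group_ring_mult G y z)"
proof -
  interpret group G by fact
  show ?thesis
    unfolding group_ring_mult_def frag_extend_frag_extend frag_extend_of
    by (intro frag_extend_eq) (use assms(2-4) in \<open>simp add: m_assoc subset_iff\<close>)
qed

lemma ring_integral_group_ring:
  assumes "group G"
  shows "ring (integral_group_ring G)"
proof (rule ringI)
  interpret group G by fact
  show "abelian_group (integral_group_ring G)"
  proof (rule abelian_groupI)
    fix x assume x: "x \<in> carrier (integral_group_ring G)"
    have "- x \<in> carrier (integral_group_ring G)" "- x + x = 0"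
      using x by (auto simp: integral_group_ring_def)
    then show "\<exists>y\<in>carrier (integral_group_ring G).
        y \<oplus>\<^bsub>integral_group_ring G\<^esub> x = \<zero>\<^bsub>integral_group_ring G\<^esub>"
      by (intro bexI[of _ "- x"]) (simp_all add: integral_group_ring_def)
  qed (use Poly_Mapping.keys_add in \<open>fastforce simp: integral_group_ring_def add.assoc add.commute\<close>)+
  show "monoid (integral_group_ring G)"
  proof (rule monoidI)
    fix x assume x: "x \<in> carrier (integral_group_ring G)"
    have "frag_extend (\<lambda>h. frag_of (\<one>\<^bsub>G\<^esub> \<otimes>\<^bsub>G\<^esub> h)) x = frag_extend frag_of x"
      "frag_extend (\<lambda>h. frag_of (h \<otimes>\<^bsub>G\<^esub> \<one>\<^bsub>G\<^esub>)) x = frag_extend frag_of x"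
      by (intro frag_extend_eq; use x in \<open>auto simp: integral_group_ring_def\<close>)+
    then show "\<one>\<^bsub>integral_group_ring G\<^esub> \<otimes>\<^bsub>integral_group_ring G\<^esub> x = x"
      "x \<otimes>\<^bsub>integral_group_ring G\<^esub> \<one>\<^bsub>integral_group_ring G\<^esub> = x"
      by (simp_all add: integral_group_ring_def group_ring_mult_def frag_expansion[symmetric])
  qed (simp_all add: integral_group_ring_def group_ring_mult_closed group_ring_mult_assoc assms)
qed (simp_all add: integral_group_ring_def group_ring_mult_def frag_extend_add frag_extend_add_fun)

lemma augmentation_eq_frag_extend:
  "augmentation x = Poly_Mapping.lookup (frag_extend (\<lambda>_. frag_of ()) x) ()"
  by (simp add: augmentation_def frag_extend_def lookup_sum)

lemma augmentation_frag_extend: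
  assumes "\<And>i. augmentation (f i) = c"
  shows "augmentation (frag_extend f x) = augmentation x * c"
  using assms unfolding augmentation_eq_frag_extend frag_extend_frag_extend
  by (simp add: frag_extend_def lookup_sum sum_distrib_right)

lemma augmentation_mult:
  "augmentation (group_ring_mult G x y) = augmentation x * augmentation y"
proof -
  have "augmentation (frag_extend (\<lambda>h. frag_of (g \<otimes>\<^bsub>G\<^esub> h)) y) = augmentation y" for g
    using augmentation_frag_extend[of "\<lambda>h. frag_of (g \<otimes>\<^bsub>G\<^esub> h)" 1 y]
    by (simp add: augmentation_def)
  then show ?thesis
    unfolding group_ring_mult_def by (rule augmentation_frag_extend)
qed

lemma group_normalized_units:
  assumes "group G"
  shows "group (normalized_units G)"
proof -
  let ?R = "integral_group_ring G"
  interpret R: ring ?R using assms by (rule ring_integral_group_ring)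
  have aug_mult: "augmentation (x \<otimes>\<^bsub>?R\<^esub> y) = augmentation x * augmentation y" for x y
    by (simp add: integral_group_ring_def augmentation_mult)
  have aug_one: "augmentation \<one>\<^bsub>?R\<^esub> = 1"
    by (simp add: integral_group_ring_def augmentation_def)
  interpret U: group "units_of ?R" by (rule R.units_group)
  have "subgroup {u \<in> Units ?R. augmentation u = 1} (units_of ?R)"
  proof (rule U.subgroupI)
    fix u assume u: "u \<in> {u \<in> Units ?R. augmentation u = 1}"
    have "augmentation u * augmentation (inv\<^bsub>?R\<^esub> u) = 1"
      using u aug_mult[of u "inv\<^bsub>?R\<^esub> u"] aug_one by (simp add: R.Units_r_inv)
    then have "augmentation (inv\<^bsub>?R\<^esub> u) = 1"
      using u by simp
    then show "inv\<^bsub>units_of ?R\<^esub> u \<in> {u \<in> Units ?R. augmentation u = 1}"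
      using u by (simp add: R.units_of_inv)
  qed (use aug_one in \<open>auto simp: units_of_carrier units_of_mult aug_mult\<close>)
  then show ?thesis
    unfolding normalized_units_def by (rule U.subgroup_imp_group)
qed

end

theory Submission
  imports Defs
begin

text \<open>
  Write \<open>tr x\<close> for the coefficient of \<open>x\<close> at the identity and \<open>x\<^sup>*\<close> for the image of \<open>x\<close> under
  inversion of group elements. If \<open>c = c\<^sup>*\<close> then \<open>tr (c\<^sup>2)\<close> is the sum of the squared
  coefficients of \<open>c\<close>, in particular \<open>tr (c\<^sup>2) \<ge> (tr c)\<^sup>2\<close>; iterating this, \<open>tr (c\<^sup>m) \<le> C K\<^sup>m\<close>
  for all \<open>m\<close> forces \<open>tr (c\<^sup>2) \<le> K\<^sup>2\<close>. If \<open>v\<close> is a torsion unit over an abelian group, the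
  powers of \<open>c = v v\<^sup>*\<close> are finite in number, so \<open>K = 1\<close> works and \<open>v\<close> is a group element up to
  sign (Higman). Over \<open>G/A\<^sup>2\<close>, which is abelian, this determines the partial augmentations
  of \<open>u\<close> at the elements outside \<open>A\<close>, as their classes are the cosets of \<open>A\<^sup>2\<close>.

  Let \<open>t \<notin> A\<close>. For \<open>u = \<alpha> + \<beta> t\<close> the partial augmentations at elements of \<open>A\<close> are read off from
  \<open>\<tau> = \<alpha> + \<alpha>\<^sup>*\<close>. This element is central, and it is the sum of the commuting torsion elements \<open>u\<close>
  and \<open>\<alpha>\<^sup>* - \<beta> t\<close>, so \<open>tr (\<tau>\<^sup>m) \<le> C 2\<^sup>m\<close>. Hence the squared coefficients of \<open>\<tau>\<close> sum to at
  most \<open>4\<close>, and to at most \<open>3\<close> if \<open>\<tau>\<close> has augmentation \<open>0\<close> (otherwise \<open>tr (\<tau>\<^sup>4) \<le> 16\<close> gives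
  \<open>\<tau>\<^sup>2 = 4\<close>). As \<open>\<tau>\<close> is symmetric with augmentation \<open>2\<close> or \<open>0\<close> and even coefficients at
  involutions, \<open>\<tau> = a + inv a\<close> or \<open>\<tau> = 0\<close>.
\<close>

section \<open>Linear extension and products in the group ring\<close>

lemma lookup_frag_extend:
  "Poly_Mapping.lookup (frag_extend f x) k =
     (\<Sum>g\<in>Poly_Mapping.keys x. Poly_Mapping.lookup x g * Poly_Mapping.lookup (f g) k)"
  by (simp add: frag_extend_def lookup_sum)

lemma frag_extend_swap:
  "frag_extend (\<lambda>g. frag_extend (F g) y) x = frag_extend (\<lambda>h. frag_extend (\<lambda>g. F g h) x) y"
proof (rule poly_mapping_eqI)
  fix k
  show "Poly_Mapping.lookup (frag_extend (\<lambda>g. frag_extend (F g) y) x) k =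
      Poly_Mapping.lookup (frag_extend (\<lambda>h. frag_extend (\<lambda>g. F g h) x) y) k"
    unfolding lookup_frag_extend sum_distrib_left
    by (subst sum.swap) (simp add: mult_ac)
qed

lemma group_ring_mult_frag_extend_left:
  "group_ring_mult G (frag_extend f x) y = frag_extend (\<lambda>g. group_ring_mult G (f g) y) x"
  by (simp add: group_ring_mult_def frag_extend_frag_extend)

lemma group_ring_mult_frag_extend_right:
  "group_ring_mult G x (frag_extend f y) = frag_extend (\<lambda>h. group_ring_mult G x (f h)) y"
  unfolding group_ring_mult_def frag_extend_frag_extend by (rule frag_extend_swap)

lemma group_ring_mult_frag_of [simp]:
  "group_ring_mult G (frag_of g) (frag_of h) = frag_of (g \<otimes>\<^bsub>G\<^esub> h)"
  by (simp add: group_ring_mult_def)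

lemma group_ring_mult_add:
  "group_ring_mult G (x + y) z = group_ring_mult G x z + group_ring_mult G y z"
  "group_ring_mult G z (x + y) = group_ring_mult G z x + group_ring_mult G z y"
  by (simp_all add: group_ring_mult_def frag_extend_add frag_extend_add_fun)

lemma group_ring_mult_zero:
  "group_ring_mult G 0 x = 0" "group_ring_mult G x 0 = 0"
  by (simp_all add: group_ring_mult_def frag_extend_def)

lemma group_ring_mult_minus:
  "group_ring_mult G (- x) y = - group_ring_mult G x y"
  "group_ring_mult G x (- y) = - group_ring_mult G x y"
proof -
  have "group_ring_mult G x y + group_ring_mult G (- x) y = 0"
    "group_ring_mult G x y + group_ring_mult G x (- y) = 0"
    by (simp_all add: group_ring_mult_zero flip: group_ring_mult_add)
  then show "group_ring_mult G (- x) y = - group_ring_mult G x y"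
    "group_ring_mult G x (- y) = - group_ring_mult G x y"
    by (metis minus_unique)+
qed

lemma keys_subset_frag_extend:
  assumes "Poly_Mapping.keys x \<subseteq> S" "\<And>g. g \<in> S \<Longrightarrow> Poly_Mapping.keys (f g) \<subseteq> T"
  shows "Poly_Mapping.keys (frag_extend f x) \<subseteq> T"
  using keys_frag_extend[of f x] assms by blast

text \<open>Both sides are bilinear, so reversal of products need only be checked on group elements.
  The instances are inversion and the adjugate.\<close>

lemma frag_extend_antihom:
  assumes "Poly_Mapping.keys x \<subseteq> carrier G" "Poly_Mapping.keys y \<subseteq> carrier G"
    and "\<And>g h. g \<in> carrier G \<Longrightarrow> h \<in> carrier G \<Longrightarrow> f (g \<otimes>\<^bsub>G\<^esub> h) = group_ring_mult G (f h) (f g)"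
  shows "frag_extend f (group_ring_mult G x y) =
    group_ring_mult G (frag_extend f y) (frag_extend f x)"
proof -
  have "frag_extend f (group_ring_mult G x y) = frag_extend (\<lambda>g. frag_extend (\<lambda>h. f (g \<otimes>\<^bsub>G\<^esub> h)) y) x"
    by (simp add: group_ring_mult_def frag_extend_frag_extend)
  also have "\<dots> = frag_extend (\<lambda>g. frag_extend (\<lambda>h. group_ring_mult G (f h) (f g)) y) x"
    by (intro frag_extend_eq) (use assms in auto)
  also have "\<dots> = group_ring_mult G (frag_extend f y) (frag_extend f x)"
    by (simp add: group_ring_mult_frag_extend_left group_ring_mult_frag_extend_right)
  finally show ?thesis .
qed

lemma frag_extend_hom:
  assumes "Poly_Mapping.keys x \<subseteq> carrier G" "Poly_Mapping.keys y \<subseteq> carrier G"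
    and "\<pi> \<in> hom G H"
  shows "frag_extend (\<lambda>g. frag_of (\<pi> g)) (group_ring_mult G x y) =
    group_ring_mult H (frag_extend (\<lambda>g. frag_of (\<pi> g)) x) (frag_extend (\<lambda>g. frag_of (\<pi> g)) y)"
  unfolding group_ring_mult_def frag_extend_frag_extend frag_extend_of
  by (intro frag_extend_eq) (use assms in \<open>auto simp: hom_def subset_iff\<close>)

text \<open>Commutation can be tested on basis elements. The values \<open>f g\<close> are arbitrary
  ring elements because the reduced trace takes sums of two group elements as values.\<close>

lemma group_ring_mult_commute_extend:
  assumes "Poly_Mapping.keys x \<subseteq> S" "Poly_Mapping.keys y \<subseteq> T"
    and "\<And>g h. g \<in> S \<Longrightarrow> h \<in> T \<Longrightarrow>
      group_ring_mult G (f g) (frag_of h) = group_ring_mult G (frag_of h) (f g)"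
  shows "group_ring_mult G (frag_extend f x) y = group_ring_mult G y (frag_extend f x)"
proof -
  have "group_ring_mult G (frag_extend f x) (frag_extend frag_of y) =
      frag_extend (\<lambda>h. frag_extend (\<lambda>g. group_ring_mult G (f g) (frag_of h)) x) y"
    by (simp add: group_ring_mult_frag_extend_left group_ring_mult_frag_extend_right)
  also have "\<dots> = frag_extend (\<lambda>h. frag_extend (\<lambda>g. group_ring_mult G (frag_of h) (f g)) x) y"
    by (intro frag_extend_eq) (use assms in auto)
  also have "\<dots> = group_ring_mult G (frag_extend frag_of y) (frag_extend f x)"
    by (simp add: group_ring_mult_frag_extend_left group_ring_mult_frag_extend_right)
      (rule frag_extend_swap)
  finally show ?thesis
    by (simp flip: frag_expansion)
qed

lemma group_ring_mult_commute:
  assumes "comm_group G" "Poly_Mapping.keys x \<subseteq> carrier G" "Poly_Mapping.keys y \<subseteq> carrier G"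
  shows "group_ring_mult G x y = group_ring_mult G y x"
proof -
  interpret comm_group G by fact
  show ?thesis
    using group_ring_mult_commute_extend[of x "carrier G" y "carrier G" G frag_of] assms m_comm
    by (simp flip: frag_expansion)
qed

lemma augmentation_frag_extend':
  "augmentation (frag_extend f x) =
     (\<Sum>g\<in>Poly_Mapping.keys x. Poly_Mapping.lookup x g * augmentation (f g))"
  by (simp add: augmentation_eq_frag_extend frag_extend_frag_extend lookup_frag_extend)

section \<open>Integrality and growth estimates\<close>

text \<open>Nonzero integer coefficients contribute at least 1 each to the sum of squares, so the
  support is a single element, and its coefficient is the augmentation.\<close>

lemma frag_of_eqI_sum_squares:
  assumes "augmentation x = 1"
    and "(\<Sum>g\<in>Poly_Mapping.keys x. (Poly_Mapping.lookup x g)\<^sup>2) \<le> 1"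
  obtains g where "g \<in> Poly_Mapping.keys x" "x = frag_of g"
proof -
  have "Poly_Mapping.keys x \<noteq> {}"
    using assms(1) by (auto simp: augmentation_def)
  then obtain g where g: "g \<in> Poly_Mapping.keys x" by blast
  have "h = g" if h: "h \<in> Poly_Mapping.keys x" for h
  proof (rule ccontr)
    assume "h \<noteq> g"
    then have "(\<Sum>k\<in>{g,h}. (Poly_Mapping.lookup x k)\<^sup>2) \<le> 1"
      by (intro order_trans[OF sum_mono2 assms(2)]) (use g h in auto)
    moreover have "(Poly_Mapping.lookup x g)\<^sup>2 > 0" "(Poly_Mapping.lookup x h)\<^sup>2 > 0"
      using g h by (auto simp: in_keys_iff)
    ultimately show False using \<open>h \<noteq> g\<close> by auto
  qed
  then have keys: "Poly_Mapping.keys x = {g}" using g by blast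
  then have "Poly_Mapping.lookup x g = 1" using assms(1) by (simp add: augmentation_def)
  then have "x = frag_of g"
    using frag_expansion[of x] keys by (simp add: frag_extend_def)
  then show ?thesis using g that by blast
qed

text \<open>Otherwise the powers of \<open>T / K > 1\<close> would outgrow \<open>C\<close>. The
  exponents are \<open>2 ^ k\<close> because the trace inequality is iterated by doubling.\<close>

lemma le_of_iterated_square_bound:
  fixes T K C :: int
  assumes "1 \<le> K" "\<And>k::nat. T ^ (2 ^ k) \<le> C * K ^ (2 ^ k)"
  shows "T \<le> K"
proof (rule ccontr)
  assume "\<not> T \<le> K"
  define r where "r = real_of_int T / real_of_int K"
  have r1: "r > 1"
    using assms(1) \<open>\<not> T \<le> K\<close> by (simp add: r_def)
  obtain n where n: "real_of_int C < r ^ n" using real_arch_pow[OF r1] by blast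
  have "n \<le> 2 ^ n" by (simp add: less_imp_le)
  then have "r ^ n \<le> r ^ (2 ^ n)" using r1 by (intro power_increasing) auto
  moreover have "r ^ (2 ^ n) \<le> real_of_int C"
  proof -
    have "real_of_int (T ^ (2 ^ n)) \<le> real_of_int (C * K ^ (2 ^ n))"
      using assms(2)[of n] by (simp only: of_int_le_iff)
    then show ?thesis using assms(1) by (simp add: r_def power_divide pos_divide_le_eq)
  qed
  ultimately show False using n by simp
qed

lemma integral_group_ring_simps:
  "carrier (integral_group_ring G) = {x. Poly_Mapping.keys x \<subseteq> carrier G}"
  "x \<otimes>\<^bsub>integral_group_ring G\<^esub> y = group_ring_mult G x y"
  "\<one>\<^bsub>integral_group_ring G\<^esub> = frag_of \<one>\<^bsub>G\<^esub>"
  "\<zero>\<^bsub>integral_group_ring G\<^esub> = 0"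
  "x \<oplus>\<^bsub>integral_group_ring G\<^esub> y = x + y"
  by (simp_all add: integral_group_ring_def)

section \<open>The involution given by inversion, and the coefficient at the identity\<close>

definition group_ring_star :: "('a, 'b) monoid_scheme \<Rightarrow> ('a \<Rightarrow>\<^sub>0 int) \<Rightarrow> ('a \<Rightarrow>\<^sub>0 int)" where
  "group_ring_star G x = frag_extend (\<lambda>g. frag_of (inv\<^bsub>G\<^esub> g)) x"

context group
begin

lemma lookup_group_ring_mult:
  assumes "Poly_Mapping.keys x \<subseteq> carrier G" "Poly_Mapping.keys y \<subseteq> carrier G" "k \<in> carrier G"
  shows "Poly_Mapping.lookup (group_ring_mult G x y) k =
    (\<Sum>g\<in>Poly_Mapping.keys x. Poly_Mapping.lookup x g * Poly_Mapping.lookup y (inv g \<otimes> k))"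
  unfolding group_ring_mult_def lookup_frag_extend[of _ x]
proof (rule sum.cong)
  fix g assume "g \<in> Poly_Mapping.keys x"
  then have g: "g \<in> carrier G" using assms by blast
  have "Poly_Mapping.lookup (frag_extend (\<lambda>h. frag_of (g \<otimes> h)) y) k =
      (\<Sum>h\<in>Poly_Mapping.keys y. if h = inv g \<otimes> k then Poly_Mapping.lookup y h else 0)"
    unfolding lookup_frag_extend
    by (intro sum.cong) (use g assms in \<open>auto simp: lookup_single when_def inv_solve_left subset_iff\<close>)
  also have "\<dots> = Poly_Mapping.lookup y (inv g \<otimes> k)"
    by (simp add: sum.delta in_keys_iff)
  finally show "Poly_Mapping.lookup x g * Poly_Mapping.lookup (frag_extend (\<lambda>h. frag_of (g \<otimes> h)) y) k
      = Poly_Mapping.lookup x g * Poly_Mapping.lookup y (inv g \<otimes> k)" by simp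
qed simp

lemma keys_group_ring_star:
  assumes "Poly_Mapping.keys x \<subseteq> carrier G"
  shows "Poly_Mapping.keys (group_ring_star G x) \<subseteq> carrier G"
  unfolding group_ring_star_def by (rule keys_subset_frag_extend[OF assms]) simp

lemma lookup_group_ring_star:
  assumes "Poly_Mapping.keys x \<subseteq> carrier G" "g \<in> carrier G"
  shows "Poly_Mapping.lookup (group_ring_star G x) g = Poly_Mapping.lookup x (inv g)"
proof -
  have "Poly_Mapping.lookup (group_ring_star G x) g =
      (\<Sum>h\<in>Poly_Mapping.keys x. if h = inv g then Poly_Mapping.lookup x h else 0)"
    unfolding group_ring_star_def lookup_frag_extend
    by (intro sum.cong) (use assms in \<open>auto simp: lookup_single when_def subset_iff\<close>)
  also have "\<dots> = Poly_Mapping.lookup x (inv g)"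
    by (simp add: sum.delta in_keys_iff)
  finally show ?thesis .
qed

lemma group_ring_star_star:
  assumes "Poly_Mapping.keys x \<subseteq> carrier G"
  shows "group_ring_star G (group_ring_star G x) = x"
proof -
  have "group_ring_star G (group_ring_star G x) = frag_extend frag_of x"
    unfolding group_ring_star_def frag_extend_frag_extend frag_extend_of
    by (intro frag_extend_eq) (use assms in auto)
  then show ?thesis by (simp flip: frag_expansion)
qed

lemma group_ring_star_mult:
  assumes "Poly_Mapping.keys x \<subseteq> carrier G" "Poly_Mapping.keys y \<subseteq> carrier G"
  shows "group_ring_star G (group_ring_mult G x y) =
    group_ring_mult G (group_ring_star G y) (group_ring_star G x)"
  unfolding group_ring_star_def
  by (rule frag_extend_antihom[OF assms]) (simp add: inv_mult_group)

lemma lookup_one_mult_star: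
  assumes "Poly_Mapping.keys x \<subseteq> carrier G"
  shows "Poly_Mapping.lookup (group_ring_mult G x (group_ring_star G x)) \<one> =
    (\<Sum>g\<in>Poly_Mapping.keys x. (Poly_Mapping.lookup x g)\<^sup>2)"
proof -
  have "Poly_Mapping.lookup (group_ring_star G x) (inv g \<otimes> \<one>) = Poly_Mapping.lookup x g"
    if "g \<in> Poly_Mapping.keys x" for g
    using that assms by (subst lookup_group_ring_star) auto
  then show ?thesis
    using assms
    by (simp add: lookup_group_ring_mult keys_group_ring_star power2_eq_square)
qed

lemma lookup_one_square:
  assumes "Poly_Mapping.keys x \<subseteq> carrier G" "group_ring_star G x = x"
  shows "Poly_Mapping.lookup (group_ring_mult G x x) \<one> =
    (\<Sum>g\<in>Poly_Mapping.keys x. (Poly_Mapping.lookup x g)\<^sup>2)"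
  using lookup_one_mult_star[OF assms(1)] assms(2) by simp

lemma lookup_one_square_ge:
  assumes "Poly_Mapping.keys x \<subseteq> carrier G" "group_ring_star G x = x"
  shows "(Poly_Mapping.lookup x \<one>)\<^sup>2 \<le> Poly_Mapping.lookup (group_ring_mult G x x) \<one>"
proof (cases "\<one> \<in> Poly_Mapping.keys x")
  case True
  then show ?thesis
    unfolding lookup_one_square[OF assms] by (intro member_le_sum) auto
next
  case False
  then show ?thesis
    unfolding lookup_one_square[OF assms] by (simp add: in_keys_iff sum_nonneg)
qed

section \<open>Trace growth of powers of torsion elements\<close>

lemma group_ring_star_pow:
  assumes "x \<in> carrier (integral_group_ring G)" "group_ring_star G x = x"
  shows "group_ring_star G (x [^]\<^bsub>integral_group_ring G\<^esub> (m::nat)) = x [^]\<^bsub>integral_group_ring G\<^esub> m"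
proof -
  interpret R: ring "integral_group_ring G"
    by (rule ring_integral_group_ring) (rule is_group)
  show ?thesis
  proof (induction m)
    case 0
    then show ?case by (simp add: integral_group_ring_simps group_ring_star_def)
  next
    case (Suc m)
    have "x [^]\<^bsub>integral_group_ring G\<^esub> m \<in> carrier (integral_group_ring G)"
      using assms(1) by simp
    then have "group_ring_star G (x [^]\<^bsub>integral_group_ring G\<^esub> Suc m)
        = x \<otimes>\<^bsub>integral_group_ring G\<^esub> (x [^]\<^bsub>integral_group_ring G\<^esub> m)"
      using assms Suc by (simp add: integral_group_ring_simps group_ring_star_mult)
    then show ?case
      using R.nat_pow_Suc2[OF assms(1), of m] by simp
  qed
qed

lemma lookup_one_square_le:
  fixes c :: "'a \<Rightarrow>\<^sub>0 int" and K C :: int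
  assumes c: "c \<in> carrier (integral_group_ring G)" "group_ring_star G c = c"
    and K: "1 \<le> K"
    and growth: "\<And>m. Poly_Mapping.lookup (c [^]\<^bsub>integral_group_ring G\<^esub> (m::nat)) \<one> \<le> C * K ^ m"
  shows "Poly_Mapping.lookup (c [^]\<^bsub>integral_group_ring G\<^esub> (2::nat)) \<one> \<le> K\<^sup>2"
proof -
  interpret R: ring "integral_group_ring G"
    by (rule ring_integral_group_ring) (rule is_group)
  let ?T = "\<lambda>m::nat. Poly_Mapping.lookup (c [^]\<^bsub>integral_group_ring G\<^esub> m) \<one>"
  have sq: "(?T m)\<^sup>2 \<le> ?T (2 * m)" for m
  proof -
    have "c [^]\<^bsub>integral_group_ring G\<^esub> (2 * m) =
        group_ring_mult G (c [^]\<^bsub>integral_group_ring G\<^esub> m) (c [^]\<^bsub>integral_group_ring G\<^esub> m)"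
      using R.nat_pow_mult[OF c(1), of m m] by (simp add: integral_group_ring_simps mult_2)
    moreover have "Poly_Mapping.keys (c [^]\<^bsub>integral_group_ring G\<^esub> m) \<subseteq> carrier G"
      using R.nat_pow_closed[OF c(1), of m] by (simp add: integral_group_ring_simps)
    ultimately show ?thesis
      using lookup_one_square_ge group_ring_star_pow[OF c] by simp
  qed
  \<comment> \<open>The induction below squares its hypothesis and needs nonnegativity. It holds at
    exponent 2, where \<open>?T 2\<close> dominates a square.\<close>
  have nonneg: "0 \<le> ?T 2"
    using sq[of 1] by (simp add: order_trans[OF zero_le_power2])
  have "(?T 2) ^ (2 ^ k) \<le> ?T (2 * 2 ^ k)" for k
  proof (induction k)
    case (Suc k)
    have "(?T 2) ^ (2 ^ Suc k) = ((?T 2) ^ (2 ^ k))\<^sup>2"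
      by (simp add: mult.commute flip: power_mult)
    also have "\<dots> \<le> (?T (2 * 2 ^ k))\<^sup>2"
      using Suc nonneg by (intro power_mono) auto
    also have "\<dots> \<le> ?T (2 * (2 * 2 ^ k))" by (rule sq)
    finally show ?case by simp
  qed simp
  note iterated = this
  show ?thesis
  proof (rule le_of_iterated_square_bound)
    show "(?T 2) ^ (2 ^ k) \<le> C * (K\<^sup>2) ^ (2 ^ k)" for k
      using order_trans[OF iterated growth, of k] by (simp only: power_mult)
  qed (use K in \<open>simp add: one_le_power\<close>)
qed

text \<open>Exponents matter only modulo \<open>n\<close>, so finitely many products occur and the
  maximum of their traces serves as \<open>C\<close>.\<close>

lemma torsion_trace_bound:
  assumes u: "u \<in> carrier (integral_group_ring G)" "u [^]\<^bsub>integral_group_ring G\<^esub> n = \<one>\<^bsub>integral_group_ring G\<^esub>"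
    and v: "v \<in> carrier (integral_group_ring G)" "v [^]\<^bsub>integral_group_ring G\<^esub> n = \<one>\<^bsub>integral_group_ring G\<^esub>"
    and n: "0 < (n::nat)"
  obtains C where "\<And>(i::nat) (j::nat). Poly_Mapping.lookup
    (u [^]\<^bsub>integral_group_ring G\<^esub> i \<otimes>\<^bsub>integral_group_ring G\<^esub> v [^]\<^bsub>integral_group_ring G\<^esub> j) \<one> \<le> C"
proof -
  let ?R = "integral_group_ring G"
  interpret R: ring ?R
    by (rule ring_integral_group_ring) (rule is_group)
  have mod: "x [^]\<^bsub>?R\<^esub> i = x [^]\<^bsub>?R\<^esub> (i mod n)"
    if "x \<in> carrier ?R" "x [^]\<^bsub>?R\<^esub> n = \<one>\<^bsub>?R\<^esub>" for x and i :: nat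
  proof -
    have "x [^]\<^bsub>?R\<^esub> (n * (i div n) + i mod n) = (x [^]\<^bsub>?R\<^esub> n) [^]\<^bsub>?R\<^esub> (i div n) \<otimes>\<^bsub>?R\<^esub> x [^]\<^bsub>?R\<^esub> (i mod n)"
      using R.nat_pow_mult[OF that(1), of "n * (i div n)" "i mod n"]
        R.nat_pow_pow[OF that(1), of n "i div n"] by metis
    then show ?thesis using that by simp
  qed
  define f where "f i j = Poly_Mapping.lookup (u [^]\<^bsub>?R\<^esub> i \<otimes>\<^bsub>?R\<^esub> v [^]\<^bsub>?R\<^esub> j) \<one>" for i j :: nat
  have "f i j \<le> Max ((\<lambda>(i,j). f i j) ` ({..<n} \<times> {..<n}))" for i j
  proof (rule Max_ge)
    have "f i j = f (i mod n) (j mod n)"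
      unfolding f_def using mod[OF u] mod[OF v] by metis
    then show "f i j \<in> (\<lambda>(i,j). f i j) ` ({..<n} \<times> {..<n})"
      using n by (intro image_eqI[of _ _ "(i mod n, j mod n)"]) auto
  qed simp
  then show ?thesis
    using that unfolding f_def by blast
qed

text \<open>As \<open>u\<close> and \<open>v\<close> commute, the \<open>m\<close>-th power of their
  sum expands into \<open>2 ^ m\<close> monomials in \<open>u\<close> and \<open>v\<close>, each of
  bounded trace.\<close>

lemma torsion_sum_trace_growth:
  assumes u: "u \<in> carrier (integral_group_ring G)" "u [^]\<^bsub>integral_group_ring G\<^esub> n = \<one>\<^bsub>integral_group_ring G\<^esub>"
    and v: "v \<in> carrier (integral_group_ring G)" "v [^]\<^bsub>integral_group_ring G\<^esub> n = \<one>\<^bsub>integral_group_ring G\<^esub>"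
    and comm: "u \<otimes>\<^bsub>integral_group_ring G\<^esub> v = v \<otimes>\<^bsub>integral_group_ring G\<^esub> u"
    and n: "0 < (n::nat)"
  obtains C where "\<And>m::nat. Poly_Mapping.lookup
    ((u \<oplus>\<^bsub>integral_group_ring G\<^esub> v) [^]\<^bsub>integral_group_ring G\<^esub> m) \<one> \<le> C * 2 ^ m"
proof -
  let ?R = "integral_group_ring G"
  interpret R: ring ?R
    by (rule ring_integral_group_ring) (rule is_group)
  define w where "w i j = u [^]\<^bsub>?R\<^esub> i \<otimes>\<^bsub>?R\<^esub> v [^]\<^bsub>?R\<^esub> j" for i j :: nat
  have w: "w i j \<in> carrier ?R" for i j
    using u v by (simp add: w_def)
  obtain C where C: "\<And>i j. Poly_Mapping.lookup (w i j) \<one> \<le> C"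
    using torsion_trace_bound[OF u v n] unfolding w_def by blast
  let ?s = "u \<oplus>\<^bsub>?R\<^esub> v"
  have s: "?s \<in> carrier ?R" using u v by simp
  have step: "?s \<otimes>\<^bsub>?R\<^esub> w i j = w (Suc i) j \<oplus>\<^bsub>?R\<^esub> w i (Suc j)" for i j
  proof -
    have "u \<otimes>\<^bsub>?R\<^esub> w i j = w (Suc i) j"
      using u v R.nat_pow_Suc2[OF u(1), of i] by (simp add: w_def R.m_assoc del: R.nat_pow_Suc)
    moreover have "v \<otimes>\<^bsub>?R\<^esub> u [^]\<^bsub>?R\<^esub> i = u [^]\<^bsub>?R\<^esub> i \<otimes>\<^bsub>?R\<^esub> v"
      by (rule R.group_commutes_pow[OF comm u(1) v(1), symmetric])
    then have "v \<otimes>\<^bsub>?R\<^esub> w i j = w i (Suc j)"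
      using u v R.nat_pow_Suc2[OF v(1), of j]
      by (simp add: w_def del: R.nat_pow_Suc flip: R.m_assoc)
    ultimately show ?thesis
      using u v w by (simp add: R.l_distr)
  qed
  \<comment> \<open>The extra factor \<open>w i j\<close> carries the induction: absorbing one
    factor \<open>?s\<close> splits it into two monomials and doubles the bound.\<close>
  have "Poly_Mapping.lookup (?s [^]\<^bsub>?R\<^esub> m \<otimes>\<^bsub>?R\<^esub> w i j) \<one> \<le> C * 2 ^ m" for m i j
  proof (induction m arbitrary: i j)
    case 0
    then show ?case using C w by simp
  next
    case (Suc m)
    have "?s [^]\<^bsub>?R\<^esub> Suc m \<otimes>\<^bsub>?R\<^esub> w i j =
        ?s [^]\<^bsub>?R\<^esub> m \<otimes>\<^bsub>?R\<^esub> w (Suc i) j \<oplus>\<^bsub>?R\<^esub> ?s [^]\<^bsub>?R\<^esub> m \<otimes>\<^bsub>?R\<^esub> w i (Suc j)"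
      using s w step[of i j] R.m_assoc[of "?s [^]\<^bsub>?R\<^esub> m" ?s "w i j"] by (simp add: R.r_distr)
    then show ?case
      using Suc[of "Suc i" j] Suc[of i "Suc j"]
      by (simp add: integral_group_ring_simps(5) lookup_add)
  qed
  from this[of _ 0 0] have "Poly_Mapping.lookup (?s [^]\<^bsub>?R\<^esub> m) \<one> \<le> C * 2 ^ m" for m
    using s by (simp add: w_def)
  then show ?thesis using that by blast
qed

end

text \<open>Reversal is harmless for powers of a single element, so torsion passes from
  \<open>x\<close> to its image under inversion or the adjugate.\<close>

lemma frag_extend_antihom_pow:
  assumes "group G" and x: "x \<in> carrier (integral_group_ring G)"
    and closed: "\<And>g. g \<in> carrier G \<Longrightarrow> Poly_Mapping.keys (f g) \<subseteq> carrier G"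
    and one: "f \<one>\<^bsub>G\<^esub> = frag_of \<one>\<^bsub>G\<^esub>"
    and mult: "\<And>g h. g \<in> carrier G \<Longrightarrow> h \<in> carrier G \<Longrightarrow> f (g \<otimes>\<^bsub>G\<^esub> h) = group_ring_mult G (f h) (f g)"
  shows "frag_extend f (x [^]\<^bsub>integral_group_ring G\<^esub> (m::nat)) =
    frag_extend f x [^]\<^bsub>integral_group_ring G\<^esub> m"
proof -
  let ?R = "integral_group_ring G"
  interpret R: ring ?R
    by (rule ring_integral_group_ring) fact
  have fx: "frag_extend f x \<in> carrier ?R"
    using keys_subset_frag_extend[of x "carrier G" f] closed x by (auto simp: integral_group_ring_simps)
  show ?thesis
  proof (induction m)
    case 0
    then show ?case by (simp add: integral_group_ring_simps one)
  next
    case (Suc m)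
    have "x [^]\<^bsub>?R\<^esub> m \<in> carrier ?R" using x by simp
    then have "frag_extend f (x [^]\<^bsub>?R\<^esub> Suc m) = frag_extend f x \<otimes>\<^bsub>?R\<^esub> frag_extend f (x [^]\<^bsub>?R\<^esub> m)"
      using x mult by (simp add: integral_group_ring_simps frag_extend_antihom)
    then show ?case
      using Suc R.nat_pow_Suc2[OF fx, of m] by simp
  qed
qed

lemma frag_extend_hom_pow:
  assumes "group G" "group H" and x: "x \<in> carrier (integral_group_ring G)" and "\<pi> \<in> hom G H"
  shows "frag_extend (\<lambda>g. frag_of (\<pi> g)) (x [^]\<^bsub>integral_group_ring G\<^esub> (m::nat)) =
    frag_extend (\<lambda>g. frag_of (\<pi> g)) x [^]\<^bsub>integral_group_ring H\<^esub> m"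
proof -
  interpret R: ring "integral_group_ring G"
    by (rule ring_integral_group_ring) fact
  show ?thesis
  proof (induction m)
    case 0
    then show ?case using assms by (simp add: integral_group_ring_simps hom_one)
  next
    case (Suc m)
    have "x [^]\<^bsub>integral_group_ring G\<^esub> m \<in> carrier (integral_group_ring G)" using x by simp
    then show ?case
      using Suc x frag_extend_hom[OF _ _ \<open>\<pi> \<in> hom G H\<close>] by (simp add: integral_group_ring_simps)
  qed
qed

section \<open>Torsion units over abelian groups\<close>

lemma (in comm_group) torsion_unit_eq_frag_of:
  assumes v: "v \<in> carrier (integral_group_ring G)" "v [^]\<^bsub>integral_group_ring G\<^esub> n = \<one>\<^bsub>integral_group_ring G\<^esub>"
    and n: "0 < (n::nat)" and aug: "augmentation v = 1"
  obtains g where "g \<in> carrier G" "v = frag_of g"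
proof -
  let ?R = "integral_group_ring G"
  interpret R: ring ?R
    by (rule ring_integral_group_ring) (rule is_group)
  let ?v' = "group_ring_star G v"
  let ?c = "v \<otimes>\<^bsub>?R\<^esub> ?v'"
  have keys: "Poly_Mapping.keys v \<subseteq> carrier G"
    using v by (simp add: integral_group_ring_simps)
  have v': "?v' \<in> carrier ?R"
    using keys_group_ring_star[OF keys] by (simp add: integral_group_ring_simps)
  have "?v' [^]\<^bsub>?R\<^esub> n = group_ring_star G (v [^]\<^bsub>?R\<^esub> n)"
    unfolding group_ring_star_def
    by (rule frag_extend_antihom_pow[symmetric]) (use v is_group in \<open>auto simp: inv_mult_group\<close>)
  also have "\<dots> = \<one>\<^bsub>?R\<^esub>"
    by (simp add: v(2)) (simp add: integral_group_ring_simps group_ring_star_def)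
  finally have v'n: "?v' [^]\<^bsub>?R\<^esub> n = \<one>\<^bsub>?R\<^esub>" .
  have comm: "v \<otimes>\<^bsub>?R\<^esub> ?v' = ?v' \<otimes>\<^bsub>?R\<^esub> v"
    unfolding integral_group_ring_simps
    by (rule group_ring_mult_commute) (use keys keys_group_ring_star comm_group_axioms in auto)
  have c: "?c \<in> carrier ?R" using v v' by simp
  have c_star: "group_ring_star G ?c = ?c"
    using keys by (simp add: integral_group_ring_simps group_ring_star_mult keys_group_ring_star group_ring_star_star)
  obtain C where C: "\<And>(i::nat) (j::nat).
      Poly_Mapping.lookup (v [^]\<^bsub>?R\<^esub> i \<otimes>\<^bsub>?R\<^esub> ?v' [^]\<^bsub>?R\<^esub> j) \<one> \<le> C"
    using torsion_trace_bound[OF v v' v'n n] by blast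
  \<comment> \<open>Since \<open>v\<close> and \<open>?v'\<close> commute, powers of
    \<open>?c\<close> are products of equal powers of the two, so their traces are bounded: growth
    with \<open>K = 1\<close>.\<close>
  have "Poly_Mapping.lookup (?c [^]\<^bsub>?R\<^esub> m) \<one> \<le> C * 1 ^ m" for m :: nat
    using C[of m m] R.pow_mult_distrib[OF comm v(1) v', of m] by simp
  from lookup_one_square_le[OF c c_star _ this]
  have "Poly_Mapping.lookup (?c [^]\<^bsub>?R\<^esub> (2::nat)) \<one> \<le> 1" by simp
  moreover have "?c [^]\<^bsub>?R\<^esub> (2::nat) = group_ring_mult G ?c ?c"
    using c by (simp add: numeral_2_eq_2) (simp add: integral_group_ring_simps)
  \<comment> \<open>The trace of \<open>?c\<close> is thus an integer of square at most 1; it is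
    also the sum of the squared coefficients of \<open>v\<close>.\<close>
  ultimately have "(Poly_Mapping.lookup ?c \<one>)\<^sup>2 \<le> 1"
    using lookup_one_square_ge[OF _ c_star] c by (simp add: integral_group_ring_simps(1))
  then have "Poly_Mapping.lookup ?c \<one> \<le> 1"
    using power2_le_imp_le[of _ "1::int"] by simp
  then have "(\<Sum>g\<in>Poly_Mapping.keys v. (Poly_Mapping.lookup v g)\<^sup>2) \<le> 1"
    using lookup_one_mult_star[OF keys] by (simp add: integral_group_ring_simps(2))
  from frag_of_eqI_sum_squares[OF aug this] show ?thesis
    using that keys by blast
qed

lemma (in group) mult_inv_cancel_left [simp]:
  assumes "a \<in> carrier G" "z \<in> carrier G"
  shows "a \<otimes> (inv a \<otimes> z) = z" "inv a \<otimes> (a \<otimes> z) = z"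
  using assms by (simp_all flip: m_assoc)

lemma (in comm_group) conjugacy_class_eq:
  assumes "g \<in> carrier G"
  shows "conjugacy_class G g = {g}"
proof -
  have "inv x \<otimes> g \<otimes> x = g" if "x \<in> carrier G" for x
    using assms that by (simp add: m_comm[of _ g] m_assoc)
  moreover have "g = inv \<one> \<otimes> g \<otimes> \<one>" using assms by simp
  ultimately show ?thesis
    unfolding conjugacy_class_def using one_closed by blast
qed

lemma (in comm_group) unique_trace_property_torsion:
  assumes "v \<in> carrier (integral_group_ring G)" "v [^]\<^bsub>integral_group_ring G\<^esub> n = \<one>\<^bsub>integral_group_ring G\<^esub>"
    and "0 < (n::nat)" "augmentation v = 1"
  shows "unique_trace_property G v"
proof -
  obtain g where "g \<in> carrier G" "v = frag_of g"
    using torsion_unit_eq_frag_of[OF assms] by blast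
  then show ?thesis
    by (auto simp: unique_trace_property_def partial_augmentation_def conjugacy_class_eq
        intro!: bexI[of _ g])
qed

section \<open>Index-two abelian subgroups inverted by the outside elements\<close>

text \<open>The generator \<open>t\<close> is replaced by conditions on every element outside
  \<open>A\<close>, so no representative has to be carried along. \<open>A_proper\<close> and
  \<open>index_two\<close> together say that the index is exactly two.\<close>

locale inverted_abelian_subgroup = group G for G (structure) +
  fixes A :: "'a set"
  assumes A_normal: "A \<lhd> G"
    and A_comm: "comm_group (G\<lparr>carrier := A\<rparr>)"
    and A_proper: "A \<noteq> carrier G"
    and invert: "\<lbrakk>x \<in> carrier G; x \<notin> A; a \<in> A\<rbrakk> \<Longrightarrow> inv x \<otimes> a \<otimes> x = inv a"
    and index_two: "\<lbrakk>x \<in> carrier G; x \<notin> A; y \<in> carrier G; y \<notin> A\<rbrakk> \<Longrightarrow> x \<otimes> y \<in> A"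
begin

lemma A_subgroup: "subgroup A G"
  using A_normal by (simp add: normal_imp_subgroup)

lemma A_carrier [simp]: "a \<in> A \<Longrightarrow> a \<in> carrier G"
  by (rule subgroup.mem_carrier[OF A_subgroup])

lemma A_closed [simp]:
  "\<one> \<in> A" "a \<in> A \<Longrightarrow> b \<in> A \<Longrightarrow> a \<otimes> b \<in> A" "a \<in> A \<Longrightarrow> inv a \<in> A"
  using A_subgroup by (auto simp: subgroup.one_closed subgroup.m_closed subgroup.m_inv_closed)

lemma inv_in_A_iff [simp]: "x \<in> carrier G \<Longrightarrow> inv x \<in> A \<longleftrightarrow> x \<in> A"
  using A_closed(3) inv_inv by metis

lemma mult_in_A_iff [simp]:
  assumes "a \<in> A" "x \<in> carrier G"
  shows "a \<otimes> x \<in> A \<longleftrightarrow> x \<in> A" "x \<otimes> a \<in> A \<longleftrightarrow> x \<in> A"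
proof -
  have "x \<in> A" if "a \<otimes> x \<in> A"
    using A_closed(2)[OF A_closed(3)[OF assms(1)] that] assms by simp
  moreover have "x \<in> A" if "x \<otimes> a \<in> A"
    using A_closed(2)[OF that A_closed(3)[OF assms(1)]] assms by (simp add: m_assoc)
  ultimately show "a \<otimes> x \<in> A \<longleftrightarrow> x \<in> A" "x \<otimes> a \<in> A \<longleftrightarrow> x \<in> A"
    using A_closed(2) assms(1) by blast+
qed

lemma A_mult_comm: "a \<in> A \<Longrightarrow> b \<in> A \<Longrightarrow> a \<otimes> b = b \<otimes> a"
  using comm_monoid.m_comm[OF comm_group.axioms(1)[OF A_comm], of a b]
  by simp

lemma commute_outside:
  assumes "x \<in> carrier G" "x \<notin> A" "a \<in> A"
  shows "a \<otimes> x = x \<otimes> inv a" "x \<otimes> a = inv a \<otimes> x"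
proof -
  have *: "b \<otimes> x = x \<otimes> inv b" if "b \<in> A" for b
  proof -
    have "x \<otimes> (inv x \<otimes> b \<otimes> x) = b \<otimes> x"
      using assms that by (simp flip: m_assoc)
    then show ?thesis using invert[OF assms(1,2) that] by simp
  qed
  show "a \<otimes> x = x \<otimes> inv a" using * assms by simp
  show "x \<otimes> a = inv a \<otimes> x" using *[of "inv a"] assms by simp
qed

text \<open>Moving \<open>x\<close> past \<open>y \<otimes> x\<close>, an element of
  \<open>A\<close>, inverts the latter: \<open>x \<otimes> (y \<otimes> x) = inv (y \<otimes> x)
  \<otimes> x\<close>. Now cancel \<open>x\<close> on the right.\<close>

lemma mult_outside:
  assumes "x \<in> carrier G" "x \<notin> A" "y \<in> carrier G" "y \<notin> A"
  shows "inv (x \<otimes> y) = y \<otimes> x"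
proof -
  have "y \<otimes> x \<in> A" using index_two assms by simp
  then have "x \<otimes> (y \<otimes> x) = inv (y \<otimes> x) \<otimes> x"
    using commute_outside(2) assms by blast
  then have "x \<otimes> y = inv (y \<otimes> x)"
    using assms by (simp flip: m_assoc)
  then show ?thesis using assms by simp
qed

section \<open>The subgroup of squares and its abelian quotient\<close>

text \<open>This is the derived subgroup of \<open>G\<close>: commutators of \<open>a\<close> in
  \<open>A\<close> with outside elements are squares of \<open>a\<close> or \<open>inv a\<close>,
  and the quotient is abelian.\<close>

definition squares :: "'a set" where
  "squares = (\<lambda>a. a \<otimes> a) ` A"

lemma squares_in_A: "squares \<subseteq> A"
  by (auto simp: squares_def)

lemma squares_subgroup: "subgroup squares G"
proof (rule subgroupI)
  show "squares \<subseteq> carrier G"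
    using squares_in_A by auto
  show "squares \<noteq> {}"
    unfolding squares_def using A_closed(1) by blast
  fix a assume "a \<in> squares"
  then obtain c where c: "c \<in> A" "a = c \<otimes> c" by (auto simp: squares_def)
  then show "inv a \<in> squares"
    by (auto simp: squares_def inv_mult_group)
  fix b assume "b \<in> squares"
  then obtain d where d: "d \<in> A" "b = d \<otimes> d" by (auto simp: squares_def)
  have "a \<otimes> b = c \<otimes> (c \<otimes> d) \<otimes> d"
    using c d by (simp add: m_assoc)
  also have "\<dots> = c \<otimes> (d \<otimes> c) \<otimes> d"
    using c d A_mult_comm[of c d] by simp
  also have "\<dots> = (c \<otimes> d) \<otimes> (c \<otimes> d)"
    using c d by (simp add: m_assoc)
  finally show "a \<otimes> b \<in> squares" using c d by (auto simp: squares_def)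
qed

lemma squares_normal: "squares \<lhd> G"
  unfolding normal_inv_iff
proof (intro conjI ballI)
  fix x h assume x: "x \<in> carrier G" and h: "h \<in> squares"
  then have hA: "h \<in> A" using squares_in_A by blast
  show "x \<otimes> h \<otimes> inv x \<in> squares"
  proof (cases "x \<in> A")
    case True
    then have "x \<otimes> h \<otimes> inv x = h"
      using hA A_mult_comm[of x h] by (simp add: m_assoc)
    then show ?thesis using h by simp
  next
    case False
    then have "x \<otimes> h \<otimes> inv x = inv h"
      using hA x commute_outside(2)[of x h] by (simp add: m_assoc)
    then show ?thesis using h squares_subgroup by (simp add: subgroup.m_inv_closed)
  qed
qed (rule squares_subgroup)

lemma squares_coset_eqI:
  assumes "x \<in> carrier G" "a \<in> A" "y = a \<otimes> a \<otimes> x"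
  shows "squares #> y = squares #> x"
proof -
  have "y \<in> squares #> x"
    using assms by (auto simp: r_coset_def squares_def)
  then show ?thesis
    using repr_independence[OF _ assms(1) squares_subgroup] by simp
qed

lemma squares_coset_subset_iff:
  assumes "h \<in> carrier G"
  shows "squares #> h \<subseteq> A \<longleftrightarrow> h \<in> A"
  using rcos_self[OF assms squares_subgroup] squares_in_A by (auto simp: r_coset_def)

text \<open>If just one factor \<open>a\<close> lies in \<open>A\<close>, the two products differ by
  \<open>a \<otimes> a\<close> on the left. If neither does, they are inverse elements of
  \<open>A\<close>, so they differ by the square of \<open>x \<otimes> y\<close>.\<close>

lemma squares_coset_comm:
  assumes x: "x \<in> carrier G" and y: "y \<in> carrier G"
  shows "squares #> (x \<otimes> y) = squares #> (y \<otimes> x)"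
proof -
  have inside: "squares #> (a \<otimes> z) = squares #> (z \<otimes> a)"
    if "a \<in> A" "z \<in> carrier G" "z \<notin> A" for a z
    using that by (intro squares_coset_eqI[of _ a])
      (auto simp: commute_outside(2) m_assoc simp flip: m_assoc[of a "inv a"])
  show ?thesis
  proof (cases "x \<in> A"; cases "y \<in> A")
    assume "x \<notin> A" "y \<notin> A"
    then have "x \<otimes> y \<in> A" "y \<otimes> x = inv (x \<otimes> y)"
      using mult_outside[OF x _ y] index_two x y by simp_all
    then show ?thesis
      by (intro squares_coset_eqI[of _ "x \<otimes> y"]) (simp_all add: m_assoc)
  qed (use x y inside A_mult_comm in \<open>simp_all\<close>)
qed

lemma comm_group_Mod_squares: "comm_group (G Mod squares)"
proof (rule group.group_comm_groupI)
  interpret N: normal squares G by (rule squares_normal)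
  show "group (G Mod squares)" by (rule N.factorgroup_is_group)
  fix P Q assume "P \<in> carrier (G Mod squares)" "Q \<in> carrier (G Mod squares)"
  then obtain x y where "x \<in> carrier G" "P = squares #> x" "y \<in> carrier G" "Q = squares #> y"
    by (auto simp: FactGroup_def RCOSETS_def)
  then show "P \<otimes>\<^bsub>G Mod squares\<^esub> Q = Q \<otimes>\<^bsub>G Mod squares\<^esub> P"
    by (simp add: FactGroup_def N.rcos_sum squares_coset_comm)
qed

section \<open>Conjugacy classes, and partial augmentations outside \<open>A\<close>\<close>

lemma conjugacy_class_inside:
  assumes "h \<in> A"
  shows "conjugacy_class G h = {h, inv h}"
proof -
  obtain t where t: "t \<in> carrier G" "t \<notin> A"
    using A_proper A_subgroup subgroup.subset by blast
  have "inv x \<otimes> h \<otimes> x = h" if "x \<in> A" for x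
    using that assms A_mult_comm[of "inv x" h] by (simp add: m_assoc)
  then have "inv x \<otimes> h \<otimes> x \<in> {h, inv h}" if "x \<in> carrier G" for x
    using that assms invert by (cases "x \<in> A") auto
  moreover have "h = inv \<one> \<otimes> h \<otimes> \<one>" "inv h = inv t \<otimes> h \<otimes> t"
    using assms t invert by auto
  ultimately show ?thesis
    unfolding conjugacy_class_def using t one_closed by blast
qed

lemma conjugacy_class_outside:
  assumes h: "h \<in> carrier G" "h \<notin> A"
  shows "conjugacy_class G h = squares #> h"
proof
  show "conjugacy_class G h \<subseteq> squares #> h"
  proof
    fix y assume "y \<in> conjugacy_class G h"
    then obtain x where x: "x \<in> carrier G" "y = inv x \<otimes> h \<otimes> x"
      by (auto simp: conjugacy_class_def)
    \<comment> \<open>Chosen so that \<open>y = b \<otimes> b \<otimes> h\<close>: conjugation by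
      \<open>x\<close> in \<open>A\<close> contributes \<open>inv x\<close> twice; for
      \<open>x\<close> outside \<open>A\<close>, the product \<open>x \<otimes> h\<close> falls into
      \<open>A\<close> and takes this role.\<close>
    define b where "b = (if x \<in> A then inv x else x \<otimes> h)"
    have b: "b \<in> A" using x h index_two by (simp add: b_def)
    have "y = b \<otimes> b \<otimes> h"
    proof (cases "x \<in> A")
      case True
      then show ?thesis using x h commute_outside(2)[OF h True] by (simp add: b_def m_assoc)
    next
      case False
      then have b_eq: "b = x \<otimes> h" by (simp add: b_def)
      have "inv x = h \<otimes> inv b"
        using x h by (simp add: b_eq inv_mult_group)
      then have "inv x = b \<otimes> h"
        using commute_outside(1)[OF h b] by simp
      moreover have "h \<otimes> x = inv b"
        using mult_outside[OF x(1) False h] by (simp add: b_eq)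
      ultimately have "y = b \<otimes> (h \<otimes> inv b)"
        using x h b by (simp add: m_assoc)
      then show ?thesis
        using commute_outside(1)[OF h b] h b by (simp add: m_assoc)
    qed
    then show "y \<in> squares #> h" using b by (auto simp: r_coset_def squares_def)
  qed
  show "squares #> h \<subseteq> conjugacy_class G h"
  proof
    fix y assume "y \<in> squares #> h"
    then obtain a where a: "a \<in> A" "y = a \<otimes> a \<otimes> h"
      by (auto simp: r_coset_def squares_def)
    then have "y = inv (inv a) \<otimes> h \<otimes> inv a"
      using h by (simp add: m_assoc flip: commute_outside(1)[OF h a(1)])
    then show "y \<in> conjugacy_class G h"
      unfolding conjugacy_class_def using a(1)
      by (intro CollectI exI[of _ "inv a"] conjI) simp_all
  qed
qed

lemma augmentation_mod_squares:
  "augmentation (frag_extend (\<lambda>g. frag_of (squares #> g)) x) = augmentation x"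
  using augmentation_frag_extend[of "\<lambda>g. frag_of (squares #> g)" 1 x]
  by (simp add: augmentation_def)

lemma lookup_mod_squares:
  assumes "Poly_Mapping.keys x \<subseteq> carrier G" "h \<in> carrier G" "h \<notin> A"
  shows "Poly_Mapping.lookup (frag_extend (\<lambda>g. frag_of (squares #> g)) x) (squares #> h) =
    partial_augmentation G x h"
proof -
  have "squares #> g = squares #> h \<longleftrightarrow> g \<in> squares #> h" if "g \<in> carrier G" for g
    using that assms(2) repr_independence[OF _ assms(2) squares_subgroup]
      rcos_self[OF that squares_subgroup] by metis
  then have "Poly_Mapping.lookup (frag_extend (\<lambda>g. frag_of (squares #> g)) x) (squares #> h) =
      (\<Sum>g\<in>Poly_Mapping.keys x. if g \<in> squares #> h then Poly_Mapping.lookup x g else 0)"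
    unfolding lookup_frag_extend
    by (intro sum.cong) (use assms(1) in \<open>auto simp: lookup_single when_def subset_iff\<close>)
  then show ?thesis
    using assms(2,3)
    by (simp add: partial_augmentation_def conjugacy_class_outside Int_commute sum.inter_restrict)
qed

section \<open>The reduced trace and the adjugate\<close>

text \<open>For \<open>\<alpha>, \<beta>\<close> in the group ring of \<open>A\<close>, multiplication by \<open>u = \<alpha> + \<beta> t\<close> is a \<open>2 \<times> 2\<close> matrix
  over that ring; its trace is \<open>\<alpha> + \<alpha>\<^sup>*\<close> and its adjugate is the matrix of \<open>\<alpha>\<^sup>* - \<beta> t\<close>. The
  functions below are the linear maps taking \<open>u\<close> to these two elements, on the basis \<open>G\<close>.\<close>

definition trace_summand :: "'a \<Rightarrow> ('a \<Rightarrow>\<^sub>0 int)" where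
  "trace_summand g = (if g \<in> A then frag_of g + frag_of (inv g) else 0)"

definition adjugate_summand :: "'a \<Rightarrow> ('a \<Rightarrow>\<^sub>0 int)" where
  "adjugate_summand g = (if g \<in> A then frag_of (inv g) else - frag_of g)"

abbreviation reduced_trace :: "('a \<Rightarrow>\<^sub>0 int) \<Rightarrow> ('a \<Rightarrow>\<^sub>0 int)" where
  "reduced_trace \<equiv> frag_extend trace_summand"

abbreviation adjugate :: "('a \<Rightarrow>\<^sub>0 int) \<Rightarrow> ('a \<Rightarrow>\<^sub>0 int)" where
  "adjugate \<equiv> frag_extend adjugate_summand"

lemma reduced_trace_eq: "reduced_trace x = x + adjugate x"
proof -
  have "trace_summand = (\<lambda>g. frag_of g + adjugate_summand g)"
    by (auto simp: trace_summand_def adjugate_summand_def)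
  then show ?thesis
    by (simp add: frag_extend_add_fun flip: frag_expansion)
qed

lemma keys_adjugate_summand: "g \<in> carrier G \<Longrightarrow> Poly_Mapping.keys (adjugate_summand g) \<subseteq> carrier G"
  by (simp add: adjugate_summand_def)

text \<open>Adjugates of matrices reverse products. For two elements outside \<open>A\<close> the
  signs cancel and \<open>inv (g \<otimes> h) = h \<otimes> g\<close>; a single factor in
  \<open>A\<close> is inverted when moved across the other.\<close>

lemma adjugate_summand_mult:
  assumes "g \<in> carrier G" "h \<in> carrier G"
  shows "adjugate_summand (g \<otimes> h) = group_ring_mult G (adjugate_summand h) (adjugate_summand g)"
proof (cases "g \<in> A"; cases "h \<in> A")
  assume "g \<notin> A" "h \<notin> A"
  then show ?thesis
    using assms mult_outside[of g h] index_two[of g h]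
    by (simp add: adjugate_summand_def group_ring_mult_minus)
next
  assume "g \<in> A" "h \<notin> A"
  then show ?thesis
    using assms commute_outside(1)[of h g]
    by (simp add: adjugate_summand_def group_ring_mult_minus)
next
  assume "g \<notin> A" "h \<in> A"
  then show ?thesis
    using assms commute_outside(2)[of g h]
    by (simp add: adjugate_summand_def group_ring_mult_minus)
qed (use assms in \<open>simp add: adjugate_summand_def inv_mult_group\<close>)

text \<open>Conjugation by an element outside \<open>A\<close> swaps the summands \<open>g\<close>
  and \<open>inv g\<close>, and elements of \<open>A\<close> commute with both.\<close>

lemma reduced_trace_central:
  assumes "Poly_Mapping.keys x \<subseteq> carrier G" "Poly_Mapping.keys y \<subseteq> carrier G"
  shows "group_ring_mult G (reduced_trace x) y = group_ring_mult G y (reduced_trace x)"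
proof (rule group_ring_mult_commute_extend[OF assms])
  fix g h assume gh: "g \<in> carrier G" "h \<in> carrier G"
  show "group_ring_mult G (trace_summand g) (frag_of h) = group_ring_mult G (frag_of h) (trace_summand g)"
  proof (cases "g \<in> A"; cases "h \<in> A")
    assume "g \<in> A" "h \<in> A"
    then show ?thesis
      using A_mult_comm[of g h] A_mult_comm[of "inv g" h]
      by (simp add: trace_summand_def group_ring_mult_add)
  next
    assume "g \<in> A" "h \<notin> A"
    then show ?thesis
      using gh commute_outside(2)[of h g] commute_outside(2)[of h "inv g"]
      by (simp add: trace_summand_def group_ring_mult_add)
  qed (simp_all add: trace_summand_def group_ring_mult_zero)
qed

lemma keys_reduced_trace: "Poly_Mapping.keys (reduced_trace x) \<subseteq> A"
proof (rule keys_subset_frag_extend)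
  show "Poly_Mapping.keys (trace_summand g) \<subseteq> A" for g
    using Poly_Mapping.keys_add[of "frag_of g" "frag_of (inv g)"]
    by (auto simp: trace_summand_def)
qed (rule subset_UNIV)

lemma lookup_reduced_trace:
  assumes "Poly_Mapping.keys x \<subseteq> carrier G" "h \<in> A"
  shows "Poly_Mapping.lookup (reduced_trace x) h = Poly_Mapping.lookup x h + Poly_Mapping.lookup x (inv h)"
proof -
  have "Poly_Mapping.lookup (adjugate x) h =
      (\<Sum>g\<in>Poly_Mapping.keys x. if g = inv h then Poly_Mapping.lookup x g else 0)"
    unfolding lookup_frag_extend
  proof (rule sum.cong)
    fix g assume "g \<in> Poly_Mapping.keys x"
    then have "g \<in> carrier G" using assms by blast
    then show "Poly_Mapping.lookup x g * Poly_Mapping.lookup (adjugate_summand g) h =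
        (if g = inv h then Poly_Mapping.lookup x g else 0)"
      using assms(2) by (auto simp: adjugate_summand_def lookup_single when_def)
  qed simp
  also have "\<dots> = Poly_Mapping.lookup x (inv h)"
    by (simp add: sum.delta in_keys_iff)
  finally show ?thesis by (simp add: reduced_trace_eq lookup_add)
qed

lemma lookup_reduced_trace_inv:
  assumes "Poly_Mapping.keys x \<subseteq> carrier G" "h \<in> A"
  shows "Poly_Mapping.lookup (reduced_trace x) (inv h) = Poly_Mapping.lookup (reduced_trace x) h"
  using assms by (simp add: lookup_reduced_trace)

lemma group_ring_star_reduced_trace:
  assumes "Poly_Mapping.keys x \<subseteq> carrier G"
  shows "group_ring_star G (reduced_trace x) = reduced_trace x"
  unfolding group_ring_star_def frag_extend_frag_extend
  by (intro frag_extend_eq) (use assms in \<open>auto simp: trace_summand_def frag_extend_add add.commute\<close>)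

text \<open>If \<open>h = inv h\<close>, the reduced trace counts the single coefficient twice; so
  nonvanishing is compared rather than the values.\<close>

lemma partial_augmentation_inside:
  assumes "Poly_Mapping.keys x \<subseteq> carrier G" "h \<in> A"
  shows "partial_augmentation G x h \<noteq> 0 \<longleftrightarrow> Poly_Mapping.lookup (reduced_trace x) h \<noteq> 0"
proof -
  have "partial_augmentation G x h = (\<Sum>g\<in>{h, inv h}. Poly_Mapping.lookup x g)"
    unfolding partial_augmentation_def conjugacy_class_inside[OF assms(2)]
    by (rule sum.mono_neutral_left) (auto simp: in_keys_iff)
  then show ?thesis
    using assms by (cases "h = inv h") (auto simp: lookup_reduced_trace)
qed

lemma reduced_trace_even:
  assumes "Poly_Mapping.keys x \<subseteq> carrier G" "h \<in> A" "inv h = h"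
  shows "even (Poly_Mapping.lookup (reduced_trace x) h)"
  using assms by (simp add: lookup_reduced_trace)

section \<open>Coefficient bounds for the reduced trace of a torsion element\<close>

lemma reduced_trace_sum_squares_le:
  assumes u: "u \<in> carrier (integral_group_ring G)" "u [^]\<^bsub>integral_group_ring G\<^esub> n = \<one>\<^bsub>integral_group_ring G\<^esub>"
    and n: "0 < (n::nat)"
  defines "\<tau> \<equiv> reduced_trace u"
  shows "(\<Sum>g\<in>Poly_Mapping.keys \<tau>. (Poly_Mapping.lookup \<tau> g)\<^sup>2) \<le> 4"
    and "augmentation \<tau> = 0 \<Longrightarrow> (\<Sum>g\<in>Poly_Mapping.keys \<tau>. (Poly_Mapping.lookup \<tau> g)\<^sup>2) \<le> 3"
proof -
  let ?R = "integral_group_ring G"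
  interpret R: ring ?R
    by (rule ring_integral_group_ring) (rule is_group)
  have keys: "Poly_Mapping.keys u \<subseteq> carrier G"
    using u by (simp add: integral_group_ring_simps)
  have keys_\<tau>: "Poly_Mapping.keys \<tau> \<subseteq> carrier G"
    using keys_reduced_trace[of u] A_carrier unfolding \<tau>_def by blast
  then have \<tau>: "\<tau> \<in> carrier ?R" by (simp add: integral_group_ring_simps)
  have \<tau>_star: "group_ring_star G \<tau> = \<tau>"
    unfolding \<tau>_def using keys by (rule group_ring_star_reduced_trace)
  let ?v = "adjugate u"
  have v: "?v \<in> carrier ?R"
    using keys_subset_frag_extend[OF keys keys_adjugate_summand] by (simp add: integral_group_ring_simps)
  have "?v [^]\<^bsub>?R\<^esub> n = adjugate (u [^]\<^bsub>?R\<^esub> n)"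
    by (rule frag_extend_antihom_pow[symmetric])
      (use u is_group keys_adjugate_summand adjugate_summand_mult in \<open>auto simp: adjugate_summand_def[of \<one>]\<close>)
  then have vn: "?v [^]\<^bsub>?R\<^esub> n = \<one>\<^bsub>?R\<^esub>"
    using u(2) by (simp add: integral_group_ring_simps adjugate_summand_def)
  \<comment> \<open>As \<open>\<tau>\<close> is \<open>u\<close> plus its adjugate, commuting with
    \<open>\<tau>\<close> means commuting with the adjugate once the square of \<open>u\<close> is
    cancelled.\<close>
  have "group_ring_mult G \<tau> u = group_ring_mult G u \<tau>"
    unfolding \<tau>_def by (rule reduced_trace_central[OF keys keys])
  then have comm: "u \<otimes>\<^bsub>?R\<^esub> ?v = ?v \<otimes>\<^bsub>?R\<^esub> u"
    by (simp add: \<tau>_def reduced_trace_eq group_ring_mult_add integral_group_ring_simps)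
  have "\<tau> = u \<oplus>\<^bsub>?R\<^esub> ?v"
    by (simp add: \<tau>_def reduced_trace_eq integral_group_ring_simps)
  then obtain C where growth: "\<And>m::nat. Poly_Mapping.lookup (\<tau> [^]\<^bsub>?R\<^esub> m) \<one> \<le> C * 2 ^ m"
    using torsion_sum_trace_growth[OF u v vn comm n] by metis
  define s where "s = \<tau> [^]\<^bsub>?R\<^esub> (2::nat)"
  have s: "s \<in> carrier ?R" using \<tau> by (simp add: s_def)
  then have keys_s: "Poly_Mapping.keys s \<subseteq> carrier G" by (simp add: integral_group_ring_simps)
  have s_eq: "s = group_ring_mult G \<tau> \<tau>"
    unfolding s_def using \<tau> by (simp add: numeral_2_eq_2) (simp add: integral_group_ring_simps)
  have s_one: "(\<Sum>g\<in>Poly_Mapping.keys \<tau>. (Poly_Mapping.lookup \<tau> g)\<^sup>2) = Poly_Mapping.lookup s \<one>"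
    using lookup_one_square[OF keys_\<tau> \<tau>_star] by (simp add: s_eq)
  have le4: "Poly_Mapping.lookup s \<one> \<le> 4"
    using lookup_one_square_le[OF \<tau> \<tau>_star _ growth] by (simp add: s_def)
  then show "(\<Sum>g\<in>Poly_Mapping.keys \<tau>. (Poly_Mapping.lookup \<tau> g)\<^sup>2) \<le> 4"
    by (simp add: s_one)
  assume aug: "augmentation \<tau> = 0"
  have s_star: "group_ring_star G s = s"
    unfolding s_def by (rule group_ring_star_pow[OF \<tau> \<tau>_star])
  \<comment> \<open>Second use of the growth argument, now for \<open>s\<close> with base 4 in place
    of 2.\<close>
  have "Poly_Mapping.lookup (s [^]\<^bsub>?R\<^esub> m) \<one> \<le> C * 4 ^ m" for m :: nat
    using growth[of "2 * m"] by (simp add: s_def R.nat_pow_pow[OF \<tau>] power_mult)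
  from lookup_one_square_le[OF s s_star _ this]
  have "Poly_Mapping.lookup (s [^]\<^bsub>?R\<^esub> (2::nat)) \<one> \<le> 16" by simp
  moreover have "s [^]\<^bsub>?R\<^esub> (2::nat) = group_ring_mult G s s"
    using s by (simp add: numeral_2_eq_2) (simp add: integral_group_ring_simps)
  ultimately have le16: "(\<Sum>g\<in>Poly_Mapping.keys s. (Poly_Mapping.lookup s g)\<^sup>2) \<le> 16"
    using lookup_one_square[OF keys_s s_star] by simp
  \<comment> \<open>A coefficient 4 at the identity exhausts the bound 16, so \<open>s\<close> would
    be 4 times the identity, of augmentation 4. But that augmentation is the square of the one of
    \<open>\<tau>\<close>, hence 0.\<close>
  have "Poly_Mapping.lookup s \<one> \<noteq> 4"
  proof
    assume four: "Poly_Mapping.lookup s \<one> = 4"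
    have "g = \<one>" if g: "g \<in> Poly_Mapping.keys s" for g
    proof (rule ccontr)
      assume "g \<noteq> \<one>"
      have "(\<Sum>h\<in>{g, \<one>}. (Poly_Mapping.lookup s h)\<^sup>2) \<le> 16"
        by (rule order_trans[OF sum_mono2 le16]) (use g four in \<open>auto simp: in_keys_iff\<close>)
      moreover have "(Poly_Mapping.lookup s g)\<^sup>2 > 0" using g by (simp add: in_keys_iff)
      ultimately show False using \<open>g \<noteq> \<one>\<close> four by simp
    qed
    then have "Poly_Mapping.keys s = {\<one>}" using four by (auto simp: in_keys_iff)
    then have "augmentation s = 4" using four by (simp add: augmentation_def)
    then show False using aug by (simp add: s_eq augmentation_mult)
  qed
  then show "(\<Sum>g\<in>Poly_Mapping.keys \<tau>. (Poly_Mapping.lookup \<tau> g)\<^sup>2) \<le> 3"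
    using le4 by (simp add: s_one)
qed

lemma augmentation_reduced_trace:
  assumes x: "Poly_Mapping.keys x \<subseteq> carrier G" and g: "g \<in> carrier G"
    and eq: "frag_extend (\<lambda>g. frag_of (squares #> g)) x = frag_of (squares #> g)"
  shows "augmentation (reduced_trace x) = (if g \<in> A then 2 else 0)"
proof -
  \<comment> \<open>The augmentation of \<open>trace_summand\<close> depends only on membership in
    \<open>A\<close>, hence on the coset modulo \<open>squares\<close>. \<open>F\<close> expresses
    this on the quotient; twice the identity just supplies augmentation 2.\<close>
  define F where "F P = (if P \<subseteq> A then frag_of \<one> + frag_of \<one> else 0)" for P :: "'a set"
  have F: "augmentation (F (squares #> h)) = (if h \<in> A then 2 else 0)" if "h \<in> carrier G" for h
    using that by (simp add: F_def squares_coset_subset_iff augmentation_eq_frag_extend frag_extend_add lookup_add)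
  have "augmentation (trace_summand h) = (if h \<in> A then 2 else 0)" for h
    by (simp add: trace_summand_def augmentation_eq_frag_extend frag_extend_add lookup_add)
  then have "augmentation (reduced_trace x) = augmentation (frag_extend (\<lambda>h. F (squares #> h)) x)"
    unfolding augmentation_frag_extend'
    by (intro sum.cong) (use F x in auto)
  also have "frag_extend (\<lambda>h. F (squares #> h)) x = frag_extend F (frag_extend (\<lambda>h. frag_of (squares #> h)) x)"
    by (simp add: frag_extend_frag_extend)
  finally show ?thesis
    using eq F[OF g] by simp
qed

section \<open>Unique trace when \<open>A\<close> is a proper subgroup\<close>

text \<open>The coset of \<open>g0\<close> to which \<open>u\<close> reduces modulo
  \<open>squares\<close> decides the class: for \<open>g0\<close> in \<open>A\<close> it is read off
  from the reduced trace, otherwise it is the class of \<open>g0\<close>.\<close>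

lemma unique_trace_property_torsion:
  assumes u: "u \<in> carrier (integral_group_ring G)" "u [^]\<^bsub>integral_group_ring G\<^esub> n = \<one>\<^bsub>integral_group_ring G\<^esub>"
    and n: "0 < (n::nat)" and aug: "augmentation u = 1"
  shows "unique_trace_property G u"
proof -
  interpret N: normal squares G by (rule squares_normal)
  interpret Q: comm_group "G Mod squares" by (rule comm_group_Mod_squares)
  let ?\<pi> = "\<lambda>g. squares #> g"
  let ?\<phi> = "frag_extend (\<lambda>g. frag_of (?\<pi> g))"
  have \<pi>: "?\<pi> \<in> hom G (G Mod squares)" by (rule N.r_coset_hom_Mod)
  have keys: "Poly_Mapping.keys u \<subseteq> carrier G"
    using u by (simp add: integral_group_ring_simps)
  have \<phi>: "?\<phi> u \<in> carrier (integral_group_ring (G Mod squares))"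
    using keys_subset_frag_extend[OF keys, of "\<lambda>g. frag_of (?\<pi> g)" "carrier (G Mod squares)"] \<pi>
    by (auto simp: integral_group_ring_simps hom_def)
  have "?\<phi> u [^]\<^bsub>integral_group_ring (G Mod squares)\<^esub> n = ?\<phi> (u [^]\<^bsub>integral_group_ring G\<^esub> n)"
    by (rule frag_extend_hom_pow[OF is_group Q.is_group u(1) \<pi>, symmetric])
  then have \<phi>n: "?\<phi> u [^]\<^bsub>integral_group_ring (G Mod squares)\<^esub> n = \<one>\<^bsub>integral_group_ring (G Mod squares)\<^esub>"
    using u(2) hom_one[OF \<pi> is_group Q.is_group] by (simp add: integral_group_ring_simps)
  obtain P where "P \<in> carrier (G Mod squares)" "?\<phi> u = frag_of P"
    using Q.torsion_unit_eq_frag_of[OF \<phi> \<phi>n n] aug by (auto simp: augmentation_mod_squares)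
  then obtain g0 where g0: "g0 \<in> carrier G" "?\<phi> u = frag_of (?\<pi> g0)"
    by (auto simp: FactGroup_def RCOSETS_def)
  define \<tau> where "\<tau> = Poly_Mapping.lookup (reduced_trace u)"
  define S where "S = Poly_Mapping.keys (reduced_trace u)"
  have S: "finite S" "S \<subseteq> A" "h \<in> S \<longleftrightarrow> \<tau> h \<noteq> 0" for h
    using keys_reduced_trace by (auto simp: S_def \<tau>_def in_keys_iff)
  have sum_\<tau>: "sum \<tau> S = (if g0 \<in> A then 2 else 0)"
    using augmentation_reduced_trace[OF keys g0] by (simp add: augmentation_def \<tau>_def S_def)
  have \<tau>_inv: "\<tau> (inv h) = \<tau> h" if "h \<in> A" for h
    unfolding \<tau>_def by (rule lookup_reduced_trace_inv[OF keys that])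
  have S_inv: "inv h \<in> S" if "h \<in> S" for h
    using that S \<tau>_inv by (simp add: subset_iff)
  have even: "even (\<tau> h)" if "h \<in> A" "inv h = h" for h
    unfolding \<tau>_def by (rule reduced_trace_even[OF keys that])
  have inside: "partial_augmentation G u h \<noteq> 0 \<longleftrightarrow> h \<in> S" if "h \<in> A" for h
    using partial_augmentation_inside[OF keys that] by (simp add: S(3) \<tau>_def)
  have outside: "partial_augmentation G u h = (if squares #> h = squares #> g0 then 1 else 0)"
    if "h \<in> carrier G" "h \<notin> A" for h
    using lookup_mod_squares[OF keys that] g0 by (simp add: lookup_single when_def)
  \<comment> \<open>Sum of squares minus sum: at most 4 - 2 for \<open>g0\<close> in
    \<open>A\<close>, at most 3 - 0 otherwise.\<close>
  have "(\<Sum>h\<in>S. (\<tau> h)\<^sup>2 - \<tau> h) \<le> 3"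
    using reduced_trace_sum_squares_le[OF u n] sum_\<tau>
    by (auto simp: sum_subtractf S_def \<tau>_def augmentation_def split: if_splits)
  \<comment> \<open>All terms of the preceding sum are nonnegative. A negative coefficient
    contributes at least 2 at each of \<open>h\<close> and \<open>inv h\<close> if these differ, and
    at least 6 at a self-inverse \<open>h\<close>, where it is even; either exceeds 3.\<close>
  have nonneg: "0 < \<tau> h" if h: "h \<in> S" for h
  proof (rule ccontr)
    let ?f = "\<lambda>h. (\<tau> h)\<^sup>2 - \<tau> h"
    assume "\<not> 0 < \<tau> h"
    then have neg: "\<tau> h \<le> -1" using S(3) h by force
    have f: "0 \<le> ?f k" for k
    proof (cases "0 < \<tau> k")
      case True
      then have "\<tau> k * 1 \<le> \<tau> k * \<tau> k" by (intro mult_left_mono) auto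
      then show ?thesis by (simp add: power2_eq_square)
    next
      case False
      then show ?thesis by (simp add: order_trans[of _ 0])
    qed
    have hA: "h \<in> A" using S h by blast
    have "4 \<le> sum ?f {h, inv h}"
    proof (cases "inv h = h")
      case True
      then have "\<tau> h \<le> -2" using even[OF hA] neg by presburger
      then have "2 * 2 \<le> (- \<tau> h) * (- \<tau> h)" by (intro mult_mono) auto
      then show ?thesis using True \<open>\<tau> h \<le> -2\<close> by (simp add: power2_eq_square)
    next
      case False
      then have "1 * 1 \<le> (- \<tau> h) * (- \<tau> h)" using neg by (intro mult_mono) auto
      then show ?thesis
        using False neg \<tau>_inv[OF hA] by (simp add: power2_eq_square eq_commute[of h])
    qed
    also have "\<dots> \<le> sum ?f S"
      by (rule sum_mono2) (use S S_inv h f in auto)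
    also have "\<dots> \<le> 3" by fact
    finally show False by simp
  qed
  show ?thesis
  proof (cases "g0 \<in> A")
    case True
    then have sum2: "sum \<tau> S = 2" using sum_\<tau> by simp
    then obtain a where a: "a \<in> S" by (metis sum.empty equals0I zero_neq_numeral)
    then have aA: "a \<in> A" using S by blast
    have "h \<in> {a, inv a}" if h: "h \<in> S" for h
    proof (rule ccontr)
      assume h': "h \<notin> {a, inv a}"
      \<comment> \<open>The total 2 is used up on \<open>a\<close> and \<open>inv a\<close>: two
        positive coefficients, or a positive even one if \<open>a\<close> is self-inverse.\<close>
      have "2 \<le> sum \<tau> {a, inv a}"
      proof (cases "inv a = a")
        case True
        then show ?thesis using even[OF aA] nonneg[OF a] by (auto elim!: evenE)
      next
        case False
        then show ?thesis using nonneg[OF a] \<tau>_inv[OF aA] by (simp add: eq_commute[of a])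
      qed
      then have "3 \<le> sum \<tau> (insert h {a, inv a})"
        using nonneg[OF h] h' by (subst sum.insert) auto
      also have "\<dots> \<le> sum \<tau> S"
        by (rule sum_mono2) (use S(1) S_inv a h nonneg in \<open>auto simp: less_imp_le\<close>)
      finally show False using sum2 by simp
    qed
    then have "h \<in> conjugacy_class G a" if "h \<in> carrier G" "partial_augmentation G u h \<noteq> 0" for h
    proof (cases "h \<in> A")
      case False
      have "squares #> h \<noteq> squares #> g0"
        using False True squares_coset_subset_iff[OF that(1)] squares_coset_subset_iff[OF g0(1)] by auto
      then show ?thesis using outside[OF that(1) False] that(2) by simp
    qed (use inside that conjugacy_class_inside[OF aA] in auto)
    then show ?thesis
      unfolding unique_trace_property_def using inside[OF aA] a aA
      by (intro bexI[of _ a] conjI ballI impI) simp_all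
  next
    case False
    have "S = {}"
    proof (rule ccontr)
      assume "S \<noteq> {}"
      then have "0 < sum \<tau> S" using S(1) nonneg by (intro sum_pos)
      then show False using sum_\<tau> False by simp
    qed
    then have "h \<in> conjugacy_class G g0" if "h \<in> carrier G" "partial_augmentation G u h \<noteq> 0" for h
      using that inside[of h] outside[of h] rcos_self[OF that(1) squares_subgroup]
        conjugacy_class_outside[OF g0(1) False]
      by (cases "h \<in> A") (auto split: if_splits)
    then show ?thesis
      unfolding unique_trace_property_def using outside[OF g0(1) False] g0(1)
      by (intro bexI[of _ g0] conjI ballI impI) simp_all
  qed
qed

end

section \<open>From the generators to the index-two setting\<close>

text \<open>The union of \<open>A\<close> and the coset of \<open>inv t\<close> contains the
  generators and their inverses. It is closed under products, as \<open>t\<close> normalises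
  \<open>A\<close> and \<open>t \<otimes> t\<close> lies in \<open>A\<close>.\<close>

lemma (in group) generate_insert_inverting:
  assumes "subgroup A G" "t \<in> carrier G" "t [^] (2::nat) \<in> A"
    and conj: "\<And>a. a \<in> A \<Longrightarrow> inv t \<otimes> a \<otimes> t = inv a"
    and x: "x \<in> generate G (insert t A)"
  shows "x \<in> A \<or> x \<otimes> t \<in> A"
proof -
  interpret A: subgroup A G by fact
  have tt: "t \<otimes> t \<in> A" using assms(2,3) by (simp add: numeral_2_eq_2)
  have mult: "g \<otimes> h \<in> A \<or> g \<otimes> h \<otimes> t \<in> A"
    if g: "g \<in> carrier G" "g \<in> A \<or> g \<otimes> t \<in> A" and h: "h \<in> carrier G" "h \<in> A \<or> h \<otimes> t \<in> A" for g h
  proof -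
    have 1: "g \<otimes> t \<otimes> inv k = g \<otimes> k \<otimes> t" if "k \<in> A" for k
      using conj[OF that, symmetric] g(1) that assms(2) by (simp add: m_assoc)
    have "g \<otimes> h \<otimes> t \<in> A" if "g \<in> A" "h \<otimes> t \<in> A"
      using A.m_closed[OF that] g h assms(2) by (simp add: m_assoc)
    moreover have "g \<otimes> h \<otimes> t \<in> A" if "g \<otimes> t \<in> A" "h \<in> A"
      using A.m_closed[OF that(1) A.m_inv_closed[OF that(2)]] 1[OF that(2)] by simp
    moreover have "g \<otimes> h \<in> A" if gt: "g \<otimes> t \<in> A" and ht: "h \<otimes> t \<in> A"
    proof -
      \<comment> \<open>Dividing \<open>g \<otimes> t\<close> by \<open>h \<otimes> t\<close> gives,
        by rule \<open>1\<close>, the product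
        \<open>g \<otimes> h \<otimes> (t \<otimes> t)\<close>, whose last factor is then removed
        within \<open>A\<close>.\<close>
      have "g \<otimes> (h \<otimes> t) \<otimes> t \<in> A"
        using A.m_closed[OF gt A.m_inv_closed[OF ht]] 1[OF ht] by simp
      then have "g \<otimes> h \<otimes> (t \<otimes> t) \<in> A"
        using g(1) h(1) assms(2) by (simp add: m_assoc)
      from A.m_closed[OF this A.m_inv_closed[OF tt]] show ?thesis
        using g(1) h(1) assms(2) by (simp add: m_assoc[of "g \<otimes> h"])
    qed
    ultimately show ?thesis using g(2) h(2) by blast
  qed
  have sub: "insert t A \<subseteq> carrier G" using assms(2) A.subset by simp
  from x show ?thesis
  proof (induction rule: generate.induct)
    case one
    then show ?case by simp
  next
    case (incl h)
    then show ?case using tt by auto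
  next
    case (inv h)
    then show ?case using assms(2) by auto
  next
    case (eng g h)
    then show ?case using mult generate_in_carrier[OF sub] by blast
  qed
qed

lemma (in group) normalized_units_pow:
  "u [^]\<^bsub>normalized_units G\<^esub> (m::nat) = u [^]\<^bsub>integral_group_ring G\<^esub> m"
  by (induction m) (simp_all add: normalized_units_def units_of_def nat_pow_def)

theorem theorem3p4:
  fixes G (structure) and A :: "'a set" and t :: 'a
  assumes "group G"
    and "A \<lhd> G"
    and "comm_group (G\<lparr>carrier := A\<rparr>)"
    and "t \<in> carrier G"
    and "generate G (insert t A) = carrier G"
    and "t [^] (2::nat) \<in> A"
    and "\<And>a. a \<in> A \<Longrightarrow> inv t \<otimes> a \<otimes> t = inv a"
  shows "p_UT_group G"
proof -
  interpret group G by fact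
  interpret A: normal A G by fact
  have cover: "x \<in> A \<or> x \<otimes> t \<in> A" if "x \<in> carrier G" for x
    using generate_insert_inverting[OF A.subgroup_axioms assms(4,6,7)] that assms(5) by blast
  have utp: "unique_trace_property G u"
    if u: "u \<in> carrier (integral_group_ring G)" "u [^]\<^bsub>integral_group_ring G\<^esub> n = \<one>\<^bsub>integral_group_ring G\<^esub>"
      "0 < n" "augmentation u = 1" for u and n :: nat
  proof (cases "A = carrier G")
    case True
    then have "comm_group G" using assms(3) by simp
    then show ?thesis using u by (rule comm_group.unique_trace_property_torsion)
  next
    case False
    \<comment> \<open>With \<open>x = b \<otimes> inv t\<close> and \<open>b\<close> in
      \<open>A\<close>, conjugation by \<open>b\<close> fixes \<open>a\<close>, and conjugation by
      \<open>inv t\<close> inverts it as \<open>t\<close> does.\<close>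
    have conj: "inv x \<otimes> a \<otimes> x = inv a" if x: "x \<in> carrier G" "x \<notin> A" and a: "a \<in> A" for x a
    proof -
      have ac: "a \<in> carrier G" using a A.subset by blast
      define b where "b = x \<otimes> t"
      have b: "b \<in> A" using cover[OF x(1)] x(2) by (simp add: b_def)
      then have bc: "b \<in> carrier G" using A.subset by blast
      have "x = b \<otimes> inv t" using x assms(4) by (simp add: b_def m_assoc)
      then have "inv x \<otimes> a \<otimes> x = t \<otimes> (inv b \<otimes> a \<otimes> b) \<otimes> inv t"
        using assms(4) ac bc by (simp add: inv_mult_group m_assoc)
      also have "inv b \<otimes> a \<otimes> b = a"
        using comm_monoid.m_comm[OF comm_group.axioms(1)[OF assms(3)], of a b] a b ac bc
        by (simp add: m_assoc)
      also have "t \<otimes> a \<otimes> inv t = inv a"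
      proof -
        have "t \<otimes> a \<otimes> inv t = t \<otimes> (inv t \<otimes> inv a \<otimes> t) \<otimes> inv t"
          using assms(7)[OF A.m_inv_closed[OF a]] ac by simp
        then show ?thesis using ac assms(4) by (simp add: m_assoc)
      qed
      finally show ?thesis .
    qed
    interpret inverted_abelian_subgroup G A
    proof (intro inverted_abelian_subgroup.intro inverted_abelian_subgroup_axioms.intro)
      \<comment> \<open>Otherwise \<open>x \<otimes> y \<otimes> t\<close> and
        \<open>y \<otimes> t\<close> would lie in \<open>A\<close>, and so would their quotient
        \<open>x\<close>.\<close>
      show "x \<otimes> y \<in> A" if "x \<in> carrier G" "x \<notin> A" "y \<in> carrier G" "y \<notin> A" for x y
      proof (rule ccontr)
        assume "x \<otimes> y \<notin> A"
        then have "x \<otimes> y \<otimes> t \<in> A" "y \<otimes> t \<in> A"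
          using cover[of "x \<otimes> y"] cover[of y] that by auto
        from A.m_closed[OF this(1) A.m_inv_closed[OF this(2)]] have "x \<otimes> (y \<otimes> t) \<otimes> inv (y \<otimes> t) \<in> A"
          using that assms(4) by (simp add: m_assoc)
        then show False using that assms(4) by (simp add: m_assoc[of x])
      qed
    qed (rule assms(1-3) False conj; assumption)+
    show ?thesis using u by (rule unique_trace_property_torsion)
  qed
  show ?thesis
    unfolding p_UT_group_def
  proof (intro conjI ballI impI)
    fix u assume u: "u \<in> carrier (normalized_units G)"
      and "\<exists>p k::nat. Factorial_Ring.prime p \<and> group.ord (normalized_units G) u = p ^ k"
    \<comment> \<open>A prime power is positive, also for exponent 0, which excludes the value 0
      standing for infinite order.\<close>
    then have "0 < group.ord (normalized_units G) u" by (auto simp: prime_gt_0_nat)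
    moreover have "u [^]\<^bsub>integral_group_ring G\<^esub> group.ord (normalized_units G) u = \<one>\<^bsub>integral_group_ring G\<^esub>"
      using group.pow_ord_eq_1[OF group_normalized_units[OF assms(1)] u]
      by (simp add: normalized_units_pow) (simp add: normalized_units_def units_of_def)
    moreover have "u \<in> carrier (integral_group_ring G)" "augmentation u = 1"
      using u by (auto simp: normalized_units_def Units_def)
    ultimately show "unique_trace_property G u" using utp by blast
  qed fact
qed

end
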